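(* Let $p\geq 5$ be a prime and let $F_p(X,Y)=\sum_{0\leq i,j\leq p+1}C_{i,j}X^iY^j\in\mathbb{Q}[X,Y]$ be such that $F_p(X,Y)=0$ is the modular equation of $u(\tau)$ of level $p$. Then (1) $C_{p+1,0}\neq 0$ and $C_{0,p+1}\neq 0$; (2) $C_{p+1,j}=C_{j,p+1}=0$ for all $j\in\{1,2,\ldots,p+1\}$; (3) $C_{0,j}=C_{j,0}=0$ for all $j\in\{0,1,\ldots,p\}$.
   Context: $q=e^{2\pi i\tau}$ for $\tau$ in the complex upper half-plane $\mathbb{H}$, $q^r=e^{2\pi i r\tau}$ for rational $r$, $\eta(\tau)=q^{1/24}\prod_{n=1}^\infty(1-q^n)$ is the Dedekind eta function, and $$u(\tau):=\dfrac{\eta(3\tau)\eta^3(18\tau)}{\eta(6\tau)\eta^3(9\tau)}.$$ For a positive integer $n$, the modular equation for $u(\tau)$ of level $n$ is the equation $F_n(u(\tau),u(n\tau))=0$ (for all $\tau\in\mathbb{H}$), where $F_n(X,Y)\in\mathbb{C}[X,Y]$ is an irreducible polynomial (unique up to a nonzero constant factor, and which can be chosen with rational coefficients). *)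

theory Defs
  imports
    "HOL-Analysis.Analysis"
    "HOL-Computational_Algebra.Computational_Algebra"
begin

text \<open>
  The power \<open>q\<^sup>r\<close> for rational \<open>r\<close>, where \<open>q = exp (2\<pi>i\<tau>)\<close>. The argument is \<open>\<tau>\<close> and not \<open>q\<close>,
  since \<open>q\<^sup>r\<close> is not a function of \<open>q\<close>.
\<close>
definition qpow :: "complex \<Rightarrow> rat \<Rightarrow> complex" where
  "qpow \<tau> r = exp (2 * of_real pi * \<i> * of_rat r * \<tau>)"

definition dedekind_eta :: "complex \<Rightarrow> complex" where
  "dedekind_eta \<tau> = qpow \<tau> (1 / 24) * (\<Prod>n. 1 - qpow \<tau> 1 ^ Suc n)"

definition u_fn :: "complex \<Rightarrow> complex" where
  "u_fn \<tau> = (dedekind_eta (3 * \<tau>) * dedekind_eta (18 * \<tau>) ^ 3) /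
         (dedekind_eta (6 * \<tau>) * dedekind_eta (9 * \<tau>) ^ 3)"

text \<open>
  The ring \<open>\<complex>[X,Y]\<close> is represented as \<open>\<complex>[X][Y]\<close>: the inner variable is \<open>X\<close>, the outer one is \<open>Y\<close>.
\<close>
definition eval2 :: "complex poly poly \<Rightarrow> complex \<Rightarrow> complex \<Rightarrow> complex" where
  "eval2 F x y = poly (poly F [:y:]) x"

definition poly_of_coeffs :: "nat \<Rightarrow> (nat \<Rightarrow> nat \<Rightarrow> rat) \<Rightarrow> complex poly poly" where
  "poly_of_coeffs d C = (\<Sum>i\<le>d. \<Sum>j\<le>d. monom (monom (of_rat (C i j)) i) j)"

definition is_modular_equation :: "nat \<Rightarrow> complex poly poly \<Rightarrow> bool" where
  "is_modular_equation n F \<longleftrightarrow>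
     irreducible F \<and> (\<forall>\<tau>. Im \<tau> > 0 \<longrightarrow> eval2 F (u_fn \<tau>) (u_fn (of_nat n * \<tau>)) = 0)"

text \<open>Check of the conventions: \<open>X\<close> has exponent \<open>i\<close> and \<open>Y\<close> has exponent \<open>j\<close>.\<close>
lemma eval2_poly_of_coeffs:
  "eval2 (poly_of_coeffs d C) x y = (\<Sum>i\<le>d. \<Sum>j\<le>d. of_rat (C i j) * x ^ i * y ^ j)"
  by (simp add: eval2_def poly_of_coeffs_def poly_sum poly_monom poly_power)

end

theory Submission
  imports Defs "HOL-Complex_Analysis.Complex_Analysis"
begin

text \<open>
  Regard \<open>F\<^sub>p(X, Y)\<close> as a polynomial in \<open>Y\<close> with coefficients \<open>a\<^sub>j(X)\<close>. For \<open>X = u(\<tau>)\<close> it has the \<open>p + 1\<close> roots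
  \<open>u(p\<tau>)\<close> and \<open>u((\<tau> + k) / p)\<close>, \<open>0 \<le> k < p\<close>. The first is a root by the defining property of \<open>F\<^sub>p\<close>. The others
  need the relation with the arguments exchanged, \<open>F\<^sub>p(u(p\<tau>), u(\<tau>)) = 0\<close>, and then the substitution of
  \<open>(\<tau> + k) / p\<close> for \<open>\<tau>\<close>. The product of these roots is \<open>u(\<tau>)\<^bsup>p + 1\<^esup>\<close>, a property of eta products
  (lemma \<open>prod_u_of_q_conjugates\<close>). As \<open>p + 1\<close> is even, comparison of the lowest and the highest coefficient
  gives \<open>a\<^sub>0(X) = a\<^bsub>p + 1\<^esub>(X) X\<^bsup>p + 1\<^esup>\<close>, and since the degree in \<open>X\<close> is at most \<open>p + 1\<close>, the factor
  \<open>a\<^bsub>p + 1\<^esub>\<close> is a constant. This is one half of the claim, and the other half is the same argument with \<open>X\<close>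
  and \<open>Y\<close> exchanged (lemma \<open>coefficients_of_relation\<close>, applied twice).

  The symmetry \<open>F\<^sub>p(u(p\<tau>), u(\<tau>)) = 0\<close> is the only modular input. It follows from the existence of a
  \<open>\<sigma>\<close> with \<open>u(\<sigma>) = u(p\<tau>)\<close> and \<open>u(p\<sigma>) = u(\<tau>)\<close> (lemma \<open>u_fn_swap\<close>). To construct it, two transformations
  of \<open>u\<close> suffice: \<open>u(\<tau> + 1/3) = exp (2\<pi>i/3) u(\<tau>)\<close>, which is visible in the product, and the
  invariance under \<open>\<tau> \<mapsto> \<tau> / (18\<tau> + 1)\<close> (lemma \<open>u_fn_invariant\<close>). For the latter, \<open>u\<close> is expressed by values of
  a theta function at three-torsion points. The inversion formula of that function (lemma
  \<open>theta_inversion\<close>) is a consequence of Liouville's theorem and involves no undetermined constant.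
\<close>

section \<open>The exponential with period one\<close>

definition e2pi :: "complex \<Rightarrow> complex" where
  "e2pi z = exp (2 * of_real pi * \<i> * z)"

lemma e2pi_add: "e2pi (a + b) = e2pi a * e2pi b"
  by (simp add: e2pi_def exp_add ring_distribs)

lemma e2pi_minus: "e2pi (- a) = inverse (e2pi a)"
  by (simp add: e2pi_def exp_minus)

lemma e2pi_diff: "e2pi (a - b) = e2pi a / e2pi b"
  by (simp add: e2pi_def exp_diff right_diff_distrib)

lemma e2pi_power: "e2pi z ^ n = e2pi (of_nat n * z)"
  by (simp add: e2pi_def exp_of_nat_mult [symmetric] mult_ac)

lemma e2pi_0 [simp]: "e2pi 0 = 1" and e2pi_nonzero [simp]: "e2pi z \<noteq> 0"
  by (simp_all add: e2pi_def)

lemma e2pi_of_int [simp]: "e2pi (of_int k) = 1"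
  using exp_2pi_1_int [of k] by (simp add: e2pi_def mult_ac)

lemma e2pi_of_nat [simp]: "e2pi (of_nat k) = 1" and e2pi_1 [simp]: "e2pi 1 = 1"
  using e2pi_of_int [of "int k"] e2pi_of_int [of 1] by simp_all

lemma e2pi_eq_1_iff: "e2pi z = 1 \<longleftrightarrow> z \<in> \<int>"
proof
  assume "e2pi z = 1"
  then obtain n :: int where n: "Im (2 * of_real pi * \<i> * z) = of_int (2 * n) * pi"
      "Re (2 * of_real pi * \<i> * z) = 0"
    by (auto simp: e2pi_def exp_eq_1)
  then have "z = of_int n"
    by (auto simp: complex_eq_iff)
  then show "z \<in> \<int>" by simp
qed (auto elim: Ints_cases)

lemma norm_e2pi: "norm (e2pi z) = exp (- 2 * pi * Im z)"
  by (simp add: e2pi_def)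

lemma norm_e2pi_less_1: "Im z > 0 \<Longrightarrow> norm (e2pi z) < 1"
  by (simp add: norm_e2pi)

lemma e2pi_surj:
  assumes "x \<noteq> 0"
  shows "e2pi (Ln x / (2 * of_real pi * \<i>)) = x"
  using assms by (simp add: e2pi_def)

lemma holomorphic_on_e2pi [holomorphic_intros]:
  "f holomorphic_on A \<Longrightarrow> (\<lambda>z. e2pi (f z)) holomorphic_on A"
  unfolding e2pi_def by (intro holomorphic_intros)

section \<open>Infinite products\<close>

text \<open>
  The \<open>q\<close>-Pochhammer symbol \<open>(a; q)\<^sub>\<infinity>\<close>. It carries both the eta function (\<open>a = q\<close>) and
  the theta function, whose zeros in the elliptic variable come from the factors.
\<close>
definition qpoch :: "complex \<Rightarrow> complex \<Rightarrow> complex" where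
  "qpoch a q = (\<Prod>n. 1 - a * q ^ n)"

abbreviation euler_prod :: "complex \<Rightarrow> complex" where
  "euler_prod q \<equiv> qpoch q q"

lemma convergent_prod_qpoch:
  fixes a q :: complex
  assumes "norm q < 1"
  shows "convergent_prod (\<lambda>n. 1 - a * q ^ n)"
proof -
  have "summable (\<lambda>n. norm (a * q ^ n))"
    using assms by (auto simp: norm_mult norm_power intro!: summable_mult summable_geometric)
  then have "abs_convergent_prod (\<lambda>n. 1 + (- (a * q ^ n)))"
    by (intro summable_imp_abs_convergent_prod) simp
  then show ?thesis
    using abs_convergent_prod_imp_convergent_prod by force
qed

lemma qpoch_has_prod: "norm q < 1 \<Longrightarrow> (\<lambda>n. 1 - a * q ^ n) has_prod qpoch a q"
  unfolding qpoch_def by (intro convergent_prod_has_prod convergent_prod_qpoch)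

lemma qpoch_eq_0_iff: "norm q < 1 \<Longrightarrow> qpoch a q = 0 \<longleftrightarrow> (\<exists>n. a * q ^ n = 1)"
  by (subst has_prod_eq_0_iff [OF qpoch_has_prod]) auto

lemma qpoch_0 [simp]: "qpoch 0 q = 1"
  by (simp add: qpoch_def)

lemma qpoch_LIMSEQ:
  assumes "norm q < 1"
  shows "(\<lambda>N. \<Prod>n<N. 1 - a * q ^ n) \<longlonglongrightarrow> qpoch a q"
  using has_prod_imp_tendsto' [OF qpoch_has_prod [OF assms]] .

lemma qpoch_rec:
  assumes "norm q < 1"
  shows "qpoch a q = (1 - a) * qpoch (a * q) q"
proof (rule LIMSEQ_unique)
  show "(\<lambda>N. \<Prod>n<Suc N. 1 - a * q ^ n) \<longlonglongrightarrow> qpoch a q"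
    using qpoch_LIMSEQ [OF assms] by (rule LIMSEQ_Suc)
  have "(\<lambda>N. (1 - a) * (\<Prod>n<N. 1 - (a * q) * q ^ n)) \<longlonglongrightarrow> (1 - a) * qpoch (a * q) q"
    by (intro tendsto_intros qpoch_LIMSEQ assms)
  then show "(\<lambda>N. \<Prod>n<Suc N. 1 - a * q ^ n) \<longlonglongrightarrow> (1 - a) * qpoch (a * q) q"
    by (simp add: prod.lessThan_Suc_shift mult_ac del: prod.lessThan_Suc)
qed

lemma euler_prod_nonzero:
  assumes "norm q < 1"
  shows "euler_prod q \<noteq> 0"
proof
  assume "euler_prod q = 0"
  then obtain n where "q ^ Suc n = 1"
    using qpoch_eq_0_iff [OF assms] by auto
  then have "norm q ^ Suc n = 1"
    by (metis norm_one norm_power)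
  then show False
    using assms by (metis norm_ge_zero power_Suc_less_one order_less_irrefl zero_less_Suc power_less_one_iff)
qed

lemma holomorphic_on_qpoch [holomorphic_intros]:
  assumes f: "f holomorphic_on A" and g: "g holomorphic_on A"
    and A: "open A" and less: "\<And>z. z \<in> A \<Longrightarrow> norm (g z) < 1"
  shows "(\<lambda>z. qpoch (f z) (g z)) holomorphic_on A"
proof (rule holomorphic_uniform_sequence [OF A])
  show "(\<lambda>z. \<Prod>n<N. 1 - f z * g z ^ n) holomorphic_on A" for N
    by (intro holomorphic_intros f g)
next
  fix x assume "x \<in> A"
  then obtain d where d: "d > 0" "cball x d \<subseteq> A"
    using A open_contains_cball by blast
  let ?K = "cball x d"
  have cf: "continuous_on ?K f" and cg: "continuous_on ?K g"
    using d f g by (meson continuous_on_subset holomorphic_on_imp_continuous_on)+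
  obtain B where B: "\<And>z. z \<in> ?K \<Longrightarrow> norm (f z) \<le> B"
    using compact_imp_bounded [OF compact_continuous_image [OF cf compact_cball]]
    unfolding bounded_iff by blast
  obtain y where y: "y \<in> ?K" "\<And>z. z \<in> ?K \<Longrightarrow> norm (g z) \<le> norm (g y)"
    using continuous_attains_sup [OF compact_cball _ continuous_on_norm [OF cg]] d(1)
    by (metis cball_eq_empty not_less_iff_gr_or_eq)
  have r: "norm (g y) < 1"
    using y(1) d less by blast
  have "uniformly_convergent_on ?K (\<lambda>N z. \<Prod>n<N. 1 - f z * g z ^ n)"
  proof (rule uniformly_convergent_on_prod')
    show "uniformly_convergent_on ?K (\<lambda>N z. \<Sum>n<N. norm (1 - f z * g z ^ n - 1))"
    proof (rule Weierstrass_m_test')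
      show "summable (\<lambda>n. B * norm (g y) ^ n)"
        using r by (intro summable_mult summable_geometric) simp
      fix n z assume z: "z \<in> ?K"
      have "norm (f z * g z ^ n) \<le> B * norm (g y) ^ n"
        unfolding norm_mult norm_power
        by (intro mult_mono B power_mono y z order_trans [OF norm_ge_zero B [OF z]]) auto
      then show "norm (norm (1 - f z * g z ^ n - 1)) \<le> B * norm (g y) ^ n"
        by simp
    qed
  qed (auto intro!: continuous_intros cf cg)
  then obtain h where h: "uniform_limit ?K (\<lambda>N z. \<Prod>n<N. 1 - f z * g z ^ n) h sequentially"
    by (auto simp: uniformly_convergent_on_def)
  have "h z = qpoch (f z) (g z)" if "z \<in> ?K" for z
    using tendsto_uniform_limitI [OF h that] qpoch_LIMSEQ [of "g z" "f z"] LIMSEQ_unique less d that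
    by blast
  with h have "uniform_limit ?K (\<lambda>N z. \<Prod>n<N. 1 - f z * g z ^ n) (\<lambda>z. qpoch (f z) (g z)) sequentially"
    by (subst uniform_limit_cong' [of _ _ _ _ h]) auto
  then show "\<exists>d>0. cball x d \<subseteq> A \<and>
      uniform_limit (cball x d) (\<lambda>N z. \<Prod>n<N. 1 - f z * g z ^ n) (\<lambda>z. qpoch (f z) (g z)) sequentially"
    using d by blast
qed

section \<open>Inversion of the theta function\<close>

text \<open>
  Jacobi's odd theta function in product form, without the power \<open>q\<^sup>1\<^sup>/\<^sup>8\<close>, the factor
  \<open>euler_prod\<close> and a constant. None of these depends on the elliptic variable \<open>z\<close>, so
  they cancel when values are compared with the leading coefficient at \<open>z = 0\<close>.
\<close>
definition theta :: "complex \<Rightarrow> complex \<Rightarrow> complex" where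
  "theta z \<tau> = e2pi (- z / 2) * qpoch (e2pi z) (e2pi \<tau>) * qpoch (e2pi (\<tau> - z)) (e2pi \<tau>)"

text \<open>
  The part of \<open>theta\<close> that does not vanish at \<open>z = 0\<close>. Splitting off the simple zero
  gives the leading behaviour of \<open>theta\<close> at the origin.
\<close>
definition theta_cofactor :: "complex \<Rightarrow> complex \<Rightarrow> complex" where
  "theta_cofactor z \<tau> = e2pi (- z / 2) * qpoch (e2pi (\<tau> + z)) (e2pi \<tau>) * qpoch (e2pi (\<tau> - z)) (e2pi \<tau>)"

lemma theta_conv_cofactor:
  assumes "Im \<tau> > 0"
  shows "theta z \<tau> = (1 - e2pi z) * theta_cofactor z \<tau>"
  using qpoch_rec [OF norm_e2pi_less_1 [OF assms], of "e2pi z"]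
  by (simp add: theta_def theta_cofactor_def e2pi_add mult_ac)

lemma e2pi_half: "e2pi (- (1 / 2)) = -1"
  by (simp_all add: e2pi_def exp_minus)

lemma theta_add_1: "theta (z + 1) \<tau> = - theta z \<tau>"
proof -
  have "- (z + 1) / 2 = - z / 2 + - 1 / 2"
    by (simp add: field_simps)
  then have "e2pi (- (z + 1) / 2) = e2pi (- z / 2) * e2pi (- 1 / 2)"
    by (simp only: e2pi_add)
  moreover have "e2pi (\<tau> - (z + 1)) = e2pi (\<tau> - z)"
    by (simp only: e2pi_diff e2pi_add e2pi_1 mult_1_right)
  ultimately show ?thesis
    by (simp add: theta_def e2pi_half e2pi_add)
qed

lemma theta_add_tau:
  assumes "Im \<tau> > 0"
  shows "theta (z + \<tau>) \<tau> = - e2pi (- \<tau> / 2 - z) * theta z \<tau>"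
proof -
  note * = norm_e2pi_less_1 [OF assms]
  have eq: "qpoch (e2pi (- z)) (e2pi \<tau>) = (1 - e2pi (- z)) * qpoch (e2pi (\<tau> - z)) (e2pi \<tau>)"
    using qpoch_rec [OF *, of "e2pi (- z)"] by (simp add: e2pi_diff e2pi_minus divide_inverse mult_ac)
  have "theta (z + \<tau>) \<tau> = e2pi (- (z + \<tau>) / 2) * qpoch (e2pi (z + \<tau>)) (e2pi \<tau>) * qpoch (e2pi (- z)) (e2pi \<tau>)"
    by (simp add: theta_def)
  also have "- (z + \<tau>) / 2 = - z / 2 + - \<tau> / 2"
    by (simp add: field_simps)
  also have "e2pi (- z / 2 + - \<tau> / 2) * qpoch (e2pi (z + \<tau>)) (e2pi \<tau>) * qpoch (e2pi (- z)) (e2pi \<tau>) =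
      e2pi (- z / 2) * e2pi (- \<tau> / 2) * qpoch (e2pi (\<tau> + z)) (e2pi \<tau>) *
      ((1 - e2pi (- z)) * qpoch (e2pi (\<tau> - z)) (e2pi \<tau>))"
    by (simp only: eq e2pi_add add.commute [of z \<tau>])
  finally show ?thesis
    unfolding theta_conv_cofactor [OF assms] theta_cofactor_def e2pi_diff [of "- \<tau> / 2" z] e2pi_minus [of z]
    by (simp add: field_simps)
qed

lemma holomorphic_on_theta [holomorphic_intros]:
  assumes "Im \<tau> > 0" "f holomorphic_on A" "open A"
  shows "(\<lambda>z. theta (f z) \<tau>) holomorphic_on A"
  unfolding theta_def
  by (intro holomorphic_intros assms norm_e2pi_less_1) auto

lemma holomorphic_on_theta_cofactor:
  assumes "Im \<tau> > 0" "f holomorphic_on A" "open A"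
  shows "(\<lambda>z. theta_cofactor (f z) \<tau>) holomorphic_on A"
  unfolding theta_cofactor_def
  by (intro holomorphic_intros assms norm_e2pi_less_1) auto

lemma theta_cofactor_0: "theta_cofactor 0 \<tau> = euler_prod (e2pi \<tau>) ^ 2"
  by (simp add: theta_cofactor_def power2_eq_square)

lemma theta_eq_0D:
  assumes "Im \<tau> > 0" "theta z \<tau> = 0"
  obtains k l :: int where "z = of_int k + of_int l * \<tau>"
proof -
  note * = norm_e2pi_less_1 [OF assms(1)]
  have "(\<exists>n. e2pi z * e2pi \<tau> ^ n = 1) \<or> (\<exists>n. e2pi (\<tau> - z) * e2pi \<tau> ^ n = 1)"
    using assms(2) by (simp add: theta_def qpoch_eq_0_iff [OF *])
  then obtain n :: nat where "e2pi (z + of_nat n * \<tau>) = 1 \<or> e2pi (\<tau> - z + of_nat n * \<tau>) = 1"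
    by (auto simp: e2pi_add e2pi_power)
  then consider "z + of_nat n * \<tau> \<in> \<int>" | "\<tau> - z + of_nat n * \<tau> \<in> \<int>"
    by (auto simp: e2pi_eq_1_iff)
  then show ?thesis
  proof cases
    case 1
    then obtain k :: int where "z + of_nat n * \<tau> = of_int k"
      by (auto elim: Ints_cases)
    then show ?thesis
      by (intro that [of k "- int n"]) (simp add: algebra_simps)
  next
    case 2
    then obtain k :: int where "\<tau> - z + of_nat n * \<tau> = of_int k"
      by (auto elim: Ints_cases)
    then show ?thesis
      by (intro that [of "- k" "int n + 1"]) (simp add: algebra_simps)
  qed
qed

lemma e2pi_sub_1_over_id: "((\<lambda>h. (e2pi (c * h) - 1) / h) \<longlongrightarrow> 2 * of_real pi * \<i> * c) (at 0)"
proof -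
  have "((\<lambda>h. e2pi (c * h)) has_field_derivative 2 * of_real pi * \<i> * c) (at 0)"
    unfolding e2pi_def by (auto intro!: derivative_eq_intros)
  then show ?thesis
    by (simp add: has_field_derivative_iff)
qed

text \<open>
  Both sides have the same two quasi-periods \<open>1\<close> and \<open>\<tau>\<close>, the Gaussian factor being exactly
  what turns the multipliers of \<open>theta (z / \<tau>) (- 1 / \<tau>)\<close> into those of \<open>theta z \<tau>\<close>. Both vanish to first
  order on the lattice, so their quotient \<open>Q\<close> extends to a doubly periodic entire function and
  is constant by Liouville's theorem. The limit at the origin gives the constant: each theta
  function is \<open>1 - exp (2\<pi>iz)\<close>, in its own variable, times a cofactor with value
  \<open>euler_prod\<^sup>2\<close>, and the two exponentials contribute the ratio \<open>1 / \<tau>\<close>.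
\<close>
lemma theta_inversion:
  assumes \<tau>: "Im \<tau> > 0" and nz: "theta z \<tau> \<noteq> 0"
  shows "theta (z / \<tau>) (- 1 / \<tau>) * e2pi (- (z ^ 2) / (2 * \<tau>)) =
    euler_prod (e2pi (- 1 / \<tau>)) ^ 2 / (\<tau> * euler_prod (e2pi \<tau>) ^ 2) * theta z \<tau>"
proof -
  define \<tau>' where "\<tau>' = - 1 / \<tau>"
  have [simp]: "\<tau> \<noteq> 0" using \<tau> by auto
  have \<tau>': "Im \<tau>' > 0"
    using \<tau> by (auto simp: \<tau>'_def Im_divide intro!: divide_pos_pos sum_power2_gt_zero_iff [THEN iffD2])
  define \<psi> where "\<psi> = (\<lambda>z. theta (z / \<tau>) \<tau>' * e2pi (- (z ^ 2) / (2 * \<tau>)))"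
  define \<kappa> where "\<kappa> = euler_prod (e2pi \<tau>') ^ 2 / (\<tau> * euler_prod (e2pi \<tau>) ^ 2)"
  define Q where "Q = (\<lambda>z. if theta z \<tau> = 0 then \<kappa> else \<psi> z / theta z \<tau>)"
  have psi_tau: "\<psi> (z + \<tau>) = - e2pi (- \<tau> / 2 - z) * \<psi> z" for z
  proof -
    have "- ((z + \<tau>) ^ 2) / (2 * \<tau>) = (- \<tau> / 2 - z) + - (z ^ 2) / (2 * \<tau>)"
      by (simp add: field_simps power2_eq_square)
    then have "e2pi (- ((z + \<tau>) ^ 2) / (2 * \<tau>)) = e2pi (- \<tau> / 2 - z) * e2pi (- (z ^ 2) / (2 * \<tau>))"
      by (simp only: e2pi_add)
    then show ?thesis
      by (simp add: \<psi>_def add_divide_distrib theta_add_1)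
  qed
  have psi_1: "\<psi> (z + 1) = - \<psi> z" for z
  proof -
    have "theta (z / \<tau>) \<tau>' = - e2pi (- \<tau>' / 2 - (z + 1) / \<tau>) * theta ((z + 1) / \<tau>) \<tau>'"
      using theta_add_tau [OF \<tau>', of "(z + 1) / \<tau>"] by (simp add: \<tau>'_def add_divide_distrib)
    moreover have "- ((z + 1) ^ 2) / (2 * \<tau>) = (- \<tau>' / 2 - (z + 1) / \<tau>) + - (z ^ 2) / (2 * \<tau>)"
      by (simp add: \<tau>'_def field_simps power2_eq_square)
    then have "e2pi (- ((z + 1) ^ 2) / (2 * \<tau>)) = e2pi (- \<tau>' / 2 - (z + 1) / \<tau>) * e2pi (- (z ^ 2) / (2 * \<tau>))"
      by (simp only: e2pi_add)
    ultimately show ?thesis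
      by (simp add: \<psi>_def)
  qed
  have Q1: "Q (z + 1) = Q z" for z
    by (simp add: Q_def theta_add_1 psi_1)
  have Qt: "Q (z + \<tau>) = Q z" for z
    by (simp add: Q_def theta_add_tau [OF \<tau>] psi_tau)
  interpret Q1: periodic_fun_simple Q 1
    by unfold_locales (rule Q1)
  interpret Qt: periodic_fun_simple Q \<tau>
    by unfold_locales (rule Qt)
  \<comment> \<open>All zeros are lattice translates of the origin, so the behaviour there settles all of them.\<close>
  have Q_lattice: "Q (z + (of_int k + of_int l * \<tau>)) = Q z" for z k l
    using Q1.plus_of_int [of "z + of_int l * \<tau>" k] Qt.plus_of_int [of z l]
    by (simp add: add_ac)

  let ?K = "\<lambda>h. theta_cofactor h \<tau>"
  have holK: "?K holomorphic_on UNIV"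
    by (intro holomorphic_on_theta_cofactor \<tau>) auto
  have K0: "?K 0 \<noteq> 0"
    by (simp add: theta_cofactor_0 euler_prod_nonzero norm_e2pi_less_1 \<tau>)
  obtain r where r: "r > 0" "\<And>h. norm h < r \<Longrightarrow> ?K h \<noteq> 0"
  proof -
    have "isCont ?K 0"
      using holK holomorphic_on_imp_continuous_on continuous_on_eq_continuous_at open_UNIV by blast
    then show ?thesis
      using continuous_at_avoid [of 0 ?K 0] K0 that by (auto simp: dist_norm)
  qed
  define s where "s = min r 1"
  have s: "s > 0" using r by (simp add: s_def)
  have theta_nz: "theta h \<tau> \<noteq> 0" if "norm h < s" "h \<noteq> 0" for h
  proof -
    have "e2pi h \<noteq> 1"
    proof
      assume "e2pi h = 1"
      then obtain k :: int where "h = of_int k"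
        by (auto simp: e2pi_eq_1_iff elim: Ints_cases)
      with that show False
        by (auto simp: s_def)
    qed
    then show ?thesis
      using that r by (simp add: theta_conv_cofactor [OF \<tau>] s_def)
  qed
  have theta_0: "theta 0 \<tau> = 0"
    by (simp add: theta_conv_cofactor [OF \<tau>])
  have hol_psi: "\<psi> holomorphic_on UNIV" and hol_theta: "(\<lambda>z. theta z \<tau>) holomorphic_on UNIV"
    unfolding \<psi>_def by (intro holomorphic_intros \<tau> \<tau>'; simp)+
  have lim0: "(Q \<longlongrightarrow> Q 0) (at 0)"
  proof -
    let ?g = "\<lambda>h. ((e2pi (1 / \<tau> * h) - 1) / h) / ((e2pi (1 * h) - 1) / h) *
      (theta_cofactor (h / \<tau>) \<tau>' * e2pi (- (h ^ 2) / (2 * \<tau>)) / ?K h)"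
    have c1: "isCont (\<lambda>h. theta_cofactor (h / \<tau>) \<tau>') 0"
      by (rule holomorphic_on_imp_continuous_on [of _ UNIV, THEN continuous_on_interior])
         (auto intro!: holomorphic_on_theta_cofactor \<tau>' holomorphic_intros)
    have c2: "isCont ?K 0"
      by (rule holomorphic_on_imp_continuous_on [of _ UNIV, THEN continuous_on_interior])
         (auto intro!: holomorphic_on_theta_cofactor \<tau> holomorphic_intros)
    have c3: "isCont (\<lambda>h. e2pi (- (h ^ 2) / (2 * \<tau>))) 0"
      by (rule holomorphic_on_imp_continuous_on [of _ UNIV, THEN continuous_on_interior])
         (auto intro!: holomorphic_intros)
    have "(?g \<longlongrightarrow> (2 * of_real pi * \<i> * (1 / \<tau>)) / (2 * of_real pi * \<i> * 1) *
        (theta_cofactor (0 / \<tau>) \<tau>' * e2pi (- (0 ^ 2) / (2 * \<tau>)) / ?K 0)) (at 0)"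
      using K0 by (intro tendsto_intros e2pi_sub_1_over_id isContD c1 c2 c3) auto
    also have "(2 * of_real pi * \<i> * (1 / \<tau>)) / (2 * of_real pi * \<i> * 1) *
        (theta_cofactor (0 / \<tau>) \<tau>' * e2pi (- (0 ^ 2) / (2 * \<tau>)) / ?K 0) = Q 0"
      by (simp add: Q_def theta_0 \<kappa>_def theta_cofactor_0)
    finally show ?thesis
    proof (rule Lim_transform_eventually)
      have "eventually (\<lambda>h. h \<in> ball 0 s - {0}) (at (0::complex))"
        using s by (intro eventually_at_in_open) auto
      then show "eventually (\<lambda>h. ?g h = Q h) (at 0)"
      proof eventually_elim
        case (elim h)
        have "theta (h / \<tau>) \<tau>' = (1 - e2pi (h / \<tau>)) * theta_cofactor (h / \<tau>) \<tau>'"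
          by (rule theta_conv_cofactor [OF \<tau>'])
        moreover have "theta h \<tau> = (1 - e2pi h) * ?K h"
          by (rule theta_conv_cofactor [OF \<tau>])
        moreover have "theta h \<tau> \<noteq> 0"
          using elim theta_nz by auto
        moreover from calculation have "1 - e2pi h \<noteq> 0" "?K h \<noteq> 0"
          by auto
        moreover from this have "e2pi h - 1 \<noteq> 0" by auto
        ultimately show ?case
          using elim by (simp add: Q_def \<psi>_def divide_simps) (simp add: algebra_simps)
      qed
    qed
  qed
  have hol_off: "Q holomorphic_on {z. theta z \<tau> \<noteq> 0}"
    by (rule holomorphic_transform [of "\<lambda>z. \<psi> z / theta z \<tau>"])
       (auto intro!: holomorphic_intros holomorphic_on_subset [OF hol_psi]
          holomorphic_on_subset [OF hol_theta] simp: Q_def)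
  have open_off: "open {z. theta z \<tau> \<noteq> 0}"
    by (intro open_Collect_neq holomorphic_on_imp_continuous_on hol_theta continuous_intros)
  have hol0: "Q holomorphic_on ball 0 s"
  proof (rule no_isolated_singularity')
    show "Q holomorphic_on ball 0 s - {0}"
      by (rule holomorphic_on_subset [OF hol_off]) (auto simp: theta_nz)
    show "(Q \<longlongrightarrow> Q z) (at z within ball 0 s)" if "z \<in> {0}" for z
      using that lim0 s by (simp add: at_within_open [of 0 "ball 0 s"])
  qed auto
  have hol: "Q holomorphic_on UNIV"
    unfolding holomorphic_on_def
  proof (intro ballI)
    fix z :: complex
    show "Q field_differentiable (at z)"
    proof (cases "theta z \<tau> = 0")
      case False
      then show ?thesis
        using hol_off open_off holomorphic_on_imp_differentiable_at by blast
    next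
      case True
      then obtain k l :: int where z: "z = of_int k + of_int l * \<tau>"
        using theta_eq_0D [OF \<tau>] by blast
      have "Q field_differentiable (at 0)"
        using hol0 s by (auto intro!: holomorphic_on_imp_differentiable_at [of _ "ball 0 s"])
      then have "(Q \<circ> (\<lambda>x. x - z)) field_differentiable (at z)"
        by (intro field_differentiable_compose) (auto intro!: derivative_intros)
      also have "Q \<circ> (\<lambda>x. x - z) = Q"
        using Q_lattice [of "x - z" k l for x] by (auto simp: z fun_eq_iff)
      finally show ?thesis .
    qed
  qed
  have bdd: "bounded (range Q)"
  proof -
    let ?g = "\<lambda>(a, b). Q (of_real a + of_real b * \<tau>)"
    have "range Q \<subseteq> ?g ` ({0..1} \<times> {0..1})"
    proof (intro image_subsetI)
      fix z
      define b where "b = Im z / Im \<tau>"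
      define a where "a = Re z - b * Re \<tau>"
      have z: "z = of_real a + of_real b * \<tau>"
        using \<tau> by (auto simp: complex_eq_iff a_def b_def)
      have "Q (of_real (frac a) + of_real (frac b) * \<tau> + (of_int \<lfloor>a\<rfloor> + of_int \<lfloor>b\<rfloor> * \<tau>)) =
        Q (of_real (frac a) + of_real (frac b) * \<tau>)"
        by (rule Q_lattice)
      also have "of_real (frac a) + of_real (frac b) * \<tau> + (of_int \<lfloor>a\<rfloor> + of_int \<lfloor>b\<rfloor> * \<tau>) = z"
        by (simp add: z frac_def algebra_simps)
      finally have "Q z = ?g (frac a, frac b)"
        by simp
      moreover have "(frac a, frac b) \<in> {0..1} \<times> {0..1}"
        using frac_lt_1 [of a] frac_lt_1 [of b] by (auto simp: frac_ge_0 less_imp_le)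
      ultimately show "Q z \<in> ?g ` ({0..1} \<times> {0..1})"
        by blast
    qed
    moreover have "continuous_on ({0..1} \<times> {0..1}) ?g"
      unfolding case_prod_unfold
      by (intro continuous_on_compose2 [OF holomorphic_on_imp_continuous_on [OF hol]] continuous_intros) auto
    then have "compact (?g ` ({0..1} \<times> {0..1}))"
      by (intro compact_continuous_image compact_Times) auto
    ultimately show ?thesis
      using bounded_subset compact_imp_bounded by blast
  qed
  have "Q z = Q 0"
    using Liouville_theorem [OF hol bdd] by (auto simp: constant_on_def)
  then have "\<psi> z / theta z \<tau> = \<kappa>"
    using nz by (simp add: Q_def theta_0)
  then show ?thesis
    using nz by (simp add: \<psi>_def \<kappa>_def \<tau>'_def field_simps)
qed

section \<open>Transformations of u\<close>

text \<open>
  The function \<open>u\<close> in the variable \<open>q = exp (2\<pi>i\<tau>)\<close>. The powers of \<open>q\<close> in the four eta factors combine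
  to \<open>q\<^sup>1\<close>, since \<open>3 + 3 \<cdot> 18 - 6 - 3 \<cdot> 9 = 24\<close>; so \<open>u\<close> is a function on the unit disc.
\<close>
definition u_of_q :: "complex \<Rightarrow> complex" where
  "u_of_q x = x * euler_prod (x ^ 3) * euler_prod (x ^ 18) ^ 3 / (euler_prod (x ^ 6) * euler_prod (x ^ 9) ^ 3)"

lemma qpow_conv_e2pi: "qpow \<tau> r = e2pi (of_rat r * \<tau>)"
  by (simp add: qpow_def e2pi_def mult_ac)

lemma dedekind_eta_conv_euler_prod: "dedekind_eta \<tau> = e2pi (\<tau> / 24) * euler_prod (e2pi \<tau>)"
  by (simp add: dedekind_eta_def qpow_conv_e2pi qpoch_def of_rat_divide)

lemma u_fn_conv_u_of_q: "u_fn \<tau> = u_of_q (e2pi \<tau>)"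
proof -
  have "e2pi (3 * \<tau> / 24) * e2pi (18 * \<tau> / 24) ^ 3 = e2pi \<tau> * (e2pi (6 * \<tau> / 24) * e2pi (9 * \<tau> / 24) ^ 3)"
    unfolding e2pi_power e2pi_add [symmetric] by (rule arg_cong [of _ _ e2pi]) simp
  moreover have "e2pi (of_nat n * \<tau>) = e2pi \<tau> ^ n" for n
    by (simp add: e2pi_power)
  from this [of 3] this [of 18] this [of 6] this [of 9]
  have "e2pi (3 * \<tau>) = e2pi \<tau> ^ 3" "e2pi (18 * \<tau>) = e2pi \<tau> ^ 18" "e2pi (6 * \<tau>) = e2pi \<tau> ^ 6" "e2pi (9 * \<tau>) = e2pi \<tau> ^ 9"
    by simp_all
  moreover have "a * E1 * (b * E2) ^ 3 / (c * E3 * (d * E4) ^ 3) = e * E1 * E2 ^ 3 / (E3 * E4 ^ 3)"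
    if "a * b ^ 3 = e * (c * d ^ 3)" "c \<noteq> 0" "d \<noteq> 0" for a b c d e E1 E2 E3 E4 :: complex
  proof -
    have "a * E1 * (b * E2) ^ 3 / (c * E3 * (d * E4) ^ 3) = (a * b ^ 3) * (E1 * E2 ^ 3) / ((c * d ^ 3) * (E3 * E4 ^ 3))"
      by (simp add: power_mult_distrib mult_ac)
    also have "\<dots> = e * E1 * E2 ^ 3 / (E3 * E4 ^ 3)"
      unfolding that(1) using that(2,3) by simp
    finally show ?thesis .
  qed
  ultimately show ?thesis
    unfolding u_fn_def dedekind_eta_conv_euler_prod u_of_q_def by simp
qed

lemma qpoch_trisect:
  assumes "norm q < 1"
  shows "qpoch a q = qpoch a (q ^ 3) * qpoch (a * q) (q ^ 3) * qpoch (a * q ^ 2) (q ^ 3)"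
proof (rule LIMSEQ_unique)
  show "(\<lambda>N. \<Prod>n<3 * N. 1 - a * q ^ n) \<longlonglongrightarrow> qpoch a q"
    using LIMSEQ_subseq_LIMSEQ [OF qpoch_LIMSEQ [OF assms, of a], of "\<lambda>N. 3 * N"]
    by (simp add: strict_mono_def o_def)
  have q3: "norm (q ^ 3) < 1"
    using assms by (simp add: norm_power power_less_one_iff)
  have "(\<Prod>n<3 * N. 1 - a * q ^ n) =
      (\<Prod>n<N. 1 - a * (q ^ 3) ^ n) * (\<Prod>n<N. 1 - a * q * (q ^ 3) ^ n) * (\<Prod>n<N. 1 - a * q ^ 2 * (q ^ 3) ^ n)" for N
  proof (induction N)
    case (Suc N)
    have "3 * Suc N = Suc (Suc (Suc (3 * N)))"
      by simp
    then show ?case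
      by (simp only: prod.lessThan_Suc Suc.IH) (simp add: power_mult [symmetric] power_add power2_eq_square mult_ac)
  qed simp
  then show "(\<lambda>N. \<Prod>n<3 * N. 1 - a * q ^ n) \<longlonglongrightarrow>
      qpoch a (q ^ 3) * qpoch (a * q) (q ^ 3) * qpoch (a * q ^ 2) (q ^ 3)"
    by (simp only:) (intro tendsto_intros qpoch_LIMSEQ q3)
qed

text \<open>
  The three-torsion value of \<open>theta\<close>, normalised by its leading coefficient at the origin (up to a
  constant) so that the factors \<open>euler_prod\<close> in the inversion formula cancel.
\<close>
definition theta_third :: "complex \<Rightarrow> complex" where
  "theta_third \<tau> = theta (1 / 3) \<tau> / euler_prod (e2pi \<tau>) ^ 2"

lemma theta_third_add_of_int: "theta_third (\<tau> + of_int k) = theta_third \<tau>"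
  by (simp add: theta_third_def theta_def e2pi_add e2pi_diff)

lemma Im_minus_inverse_pos: "Im \<tau> > 0 \<Longrightarrow> Im (- 1 / \<tau>) > 0"
  by (auto simp: Im_divide intro!: divide_pos_pos sum_power2_gt_zero_iff [THEN iffD2])

text \<open>
  The value of \<open>theta z \<tau>\<close> at \<open>z = \<tau> / 3\<close> is an eta quotient: with \<open>y = exp (2\<pi>i\<tau> / 3)\<close>, its factors run over
  \<open>1 - y\<^sup>n\<close> for the \<open>n\<close> prime to \<open>3\<close>. Inversion moves the point \<open>\<tau> / 3\<close> to the point \<open>1 / 3\<close>, where theta is
  periodic in \<open>\<tau>\<close>.
\<close>
lemma euler_prod_cubic_quotient:
  assumes \<tau>: "Im \<tau> > 0"
  shows "euler_prod (e2pi (\<tau> / 3)) / euler_prod (e2pi \<tau>) ^ 3 = \<tau> * e2pi (\<tau> / 9) * theta_third (- 1 / \<tau>)"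
proof -
  define y where "y = e2pi (\<tau> / 3)"
  have y3: "e2pi \<tau> = y ^ 3"
    by (simp add: y_def e2pi_power)
  have y: "norm y < 1" and y3_less: "norm (y ^ 3) < 1"
    using \<tau> y3 norm_e2pi_less_1 [of "\<tau> / 3"] norm_e2pi_less_1 [of \<tau>] by (auto simp: y_def)
  note nz = euler_prod_nonzero [OF y] euler_prod_nonzero [OF y3_less]
    euler_prod_nonzero [OF norm_e2pi_less_1 [OF Im_minus_inverse_pos [OF \<tau>]]]
  have [simp]: "\<tau> \<noteq> 0" using \<tau> by auto
  have "e2pi (\<tau> - \<tau> / 3) = y ^ 3 / y"
    by (simp only: e2pi_diff y3) (simp add: y_def)
  also have "\<dots> = y ^ 2"
    by (simp add: y_def power2_eq_square power3_eq_cube)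
  finally have y2: "e2pi (\<tau> - \<tau> / 3) = y ^ 2" .
  have "theta (\<tau> / 3) \<tau> = e2pi (- (\<tau> / 3) / 2) * (qpoch y (y ^ 3) * qpoch (y ^ 2) (y ^ 3))"
    by (simp only: theta_def y2 y3 y_def [symmetric] mult.assoc)
  moreover have "euler_prod y = qpoch y (y ^ 3) * qpoch (y ^ 2) (y ^ 3) * euler_prod (y ^ 3)"
    using qpoch_trisect [OF y, of y] by (simp add: power2_eq_square power3_eq_cube mult.assoc)
  ultimately have th: "theta (\<tau> / 3) \<tau> = e2pi (- (\<tau> / 3) / 2) * (euler_prod y / euler_prod (y ^ 3))"
    using nz by simp
  have "theta (\<tau> / 3) \<tau> \<noteq> 0"
    using nz by (simp add: th)
  from theta_inversion [OF \<tau> this]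
  have "theta (1 / 3) (- 1 / \<tau>) * e2pi (- ((\<tau> / 3) ^ 2) / (2 * \<tau>)) =
      euler_prod (e2pi (- 1 / \<tau>)) ^ 2 / (\<tau> * euler_prod (y ^ 3) ^ 2) * theta (\<tau> / 3) \<tau>"
    by (simp add: y3)
  also have "- ((\<tau> / 3) ^ 2) / (2 * \<tau>) = \<tau> / 9 + - (\<tau> / 3) / 2 "
    by (simp add: field_simps power2_eq_square)
  finally have "theta (1 / 3) (- 1 / \<tau>) * e2pi (\<tau> / 9) * e2pi (- (\<tau> / 3) / 2) =
      euler_prod (e2pi (- 1 / \<tau>)) ^ 2 / (\<tau> * euler_prod (y ^ 3) ^ 2) * (euler_prod y / euler_prod (y ^ 3)) *
      e2pi (- (\<tau> / 3) / 2)"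
    unfolding th e2pi_add by (simp add: mult_ac)
  then have "theta (1 / 3) (- 1 / \<tau>) * e2pi (\<tau> / 9) =
      euler_prod (e2pi (- 1 / \<tau>)) ^ 2 / (\<tau> * euler_prod (y ^ 3) ^ 2) * (euler_prod y / euler_prod (y ^ 3))"
    by (simp only: mult_right_cancel [OF e2pi_nonzero])
  then show ?thesis
    using nz unfolding theta_third_def y3 y_def [symmetric]
    by (simp add: field_simps power2_eq_square power3_eq_cube)
qed

text \<open>
  \<open>u\<close> is the ratio of the cubic quotients at \<open>9\<tau>\<close> and \<open>18\<tau>\<close>; the exponential factors cancel, and the
  factors \<open>9\<tau>\<close> and \<open>18\<tau>\<close> leave \<open>1 / 2\<close>.
\<close>
lemma u_fn_conv_theta_third:
  assumes \<tau>: "Im \<tau> > 0"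
  shows "u_fn \<tau> = theta_third (- 1 / (9 * \<tau>)) / theta_third (- 1 / (18 * \<tau>)) / 2"
proof -
  have [simp]: "\<tau> \<noteq> 0" using \<tau> by auto
  have *: "e2pi \<tau> ^ 3 = e2pi (3 * \<tau>)" "e2pi \<tau> ^ 18 = e2pi (18 * \<tau>)" "e2pi \<tau> ^ 6 = e2pi (6 * \<tau>)" "e2pi \<tau> ^ 9 = e2pi (9 * \<tau>)"
    by (simp_all add: e2pi_power)
  have "u_fn \<tau> = e2pi \<tau> * (euler_prod (e2pi (9 * \<tau> / 3)) / euler_prod (e2pi (9 * \<tau>)) ^ 3) /
      (euler_prod (e2pi (18 * \<tau> / 3)) / euler_prod (e2pi (18 * \<tau>)) ^ 3)"
    unfolding u_fn_conv_u_of_q u_of_q_def * by simp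
  also have "\<dots> = e2pi \<tau> * (9 * \<tau> * e2pi (9 * \<tau> / 9) * theta_third (- 1 / (9 * \<tau>))) /
      (18 * \<tau> * e2pi (18 * \<tau> / 9) * theta_third (- 1 / (18 * \<tau>)))"
    using \<tau> by (subst (1 2) euler_prod_cubic_quotient) auto
  also have "e2pi (18 * \<tau> / 9) = e2pi \<tau> * e2pi (9 * \<tau> / 9)"
    by (simp flip: e2pi_add)
  finally show ?thesis
    by simp
qed

text \<open>
  Invariance under the powers of \<open>\<tau> \<mapsto> \<tau> / (18\<tau> + 1)\<close>, which act on \<open>1 / \<tau>\<close> as translations. The shift by a
  multiple of \<open>18\<close> becomes an integral shift of both \<open>- 1 / (9\<tau>)\<close> and \<open>- 1 / (18\<tau>)\<close>.
\<close>
lemma u_fn_invariant: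
  assumes \<tau>: "Im \<tau> > 0" and \<sigma>: "Im \<sigma> > 0" and eq: "1 / \<sigma> = 1 / \<tau> + 18 * of_int k"
  shows "u_fn \<sigma> = u_fn \<tau>"
proof -
  have "- 1 / (9 * \<sigma>) = - (1 / 9) * (1 / \<sigma>)" "- 1 / (18 * \<sigma>) = - (1 / 18) * (1 / \<sigma>)"
    by simp_all
  then have "- 1 / (9 * \<sigma>) = - 1 / (9 * \<tau>) + of_int (- 2 * k)"
    "- 1 / (18 * \<sigma>) = - 1 / (18 * \<tau>) + of_int (- k)"
    unfolding eq by (simp_all add: algebra_simps)
  then show ?thesis
    by (simp only: u_fn_conv_theta_third \<tau> \<sigma> theta_third_add_of_int)
qed

text \<open>
  All exponents in the products are multiples of \<open>3\<close>, so only the leading factor \<open>x\<close> changes.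
\<close>
lemma u_of_q_cube_root_unity:
  assumes "w ^ 3 = 1"
  shows "u_of_q (w * x) = w * u_of_q x"
proof -
  have "w ^ (3 * n) = 1" for n
    by (simp add: power_mult assms)
  from this [of 2] this [of 3] this [of 6] show ?thesis
    by (simp add: u_of_q_def power_mult_distrib assms)
qed

lemma u_fn_add_thirds: "u_fn (\<tau> + of_int m / 3) = e2pi (of_int m / 3) * u_fn \<tau>"
  using u_of_q_cube_root_unity [of "e2pi (of_int m / 3)" "e2pi \<tau>"]
  by (simp add: u_fn_conv_u_of_q e2pi_add e2pi_power mult.commute)

lemma u_fn_add_of_int: "u_fn (\<tau> + of_int m) = u_fn \<tau>"
  by (simp add: u_fn_conv_u_of_q e2pi_add)

lemma Im_inverse_add_inverse_pos:
  assumes "Im \<tau> > 0" "c \<in> \<real>"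
  shows "Im (inverse (c + inverse \<tau>)) > 0"
proof -
  have "Im (- 1 / \<tau>) > 0"
    by (rule Im_minus_inverse_pos) fact
  then have "Im (- (c + inverse \<tau>)) > 0"
    using assms(2) by (simp add: divide_inverse complex_is_Real_iff)
  from Im_minus_inverse_pos [OF this] show ?thesis
    by (simp add: divide_inverse del: minus_add_distrib)
qed

text \<open>
  This is the involution \<open>W\<^sub>p\<close> of Atkin and Lehner, which exchanges \<open>u(\<tau>)\<close> and \<open>u(p\<tau>)\<close>. It is given by
  a matrix \<open>[p, b; 18p, pd]\<close> with \<open>pd - 18b = 1\<close>. Writing \<open>p = \<epsilon> + 6m\<close> with \<open>\<epsilon> = \<plusminus>1\<close>, the choice
  \<open>d = \<epsilon> - 6m\<close> and \<open>b = - 2m\<^sup>2\<close> satisfies this, and it makes the two needed elements of the group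
  \<open>\<Gamma>\<^sub>0(18)\<close> explicit words in \<open>L : \<tau> \<mapsto> \<tau> / (18\<tau> + 1)\<close> and translations by thirds:
  \<open>\<sigma> = L (p\<tau> - 2m\<^sup>2)\<close> and \<open>p\<sigma> = m / 3 + L\<^sup>\<epsilon> (\<tau> - m / 3)\<close>.
  The cube roots of unity produced by the two translations in the second word cancel.
\<close>
lemma u_fn_swap:
  fixes p :: nat
  assumes \<tau>: "Im \<tau> > 0" and p: "coprime p 6" "p > 0"
  obtains \<sigma> where "Im \<sigma> > 0" "u_fn \<sigma> = u_fn (of_nat p * \<tau>)" "u_fn (of_nat p * \<sigma>) = u_fn \<tau>"
proof -
  obtain m \<epsilon> :: int where p_eq: "int p = \<epsilon> + 6 * m" and \<epsilon>: "\<epsilon> \<in> {1, -1}"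
  proof -
    have "\<not> 2 dvd p" "\<not> 3 dvd p"
      using p(1) coprime_common_divisor [of p 6 2] coprime_common_divisor [of p 6 3] by auto
    then have "int p mod 6 = 1 \<or> int p mod 6 = 5"
      by presburger
    then have "int p = 1 + 6 * (int p div 6) \<or> int p = -1 + 6 * (int p div 6 + 1)"
      by presburger
    then show ?thesis
      using that by blast
  qed
  define a where "a = of_nat p * \<tau> + of_int (- 2 * m ^ 2)"
  define b where "b = \<tau> + of_int (- m) / 3"
  define \<sigma> where "\<sigma> = inverse (18 + inverse a)"
  define x where "x = inverse (18 * of_int \<epsilon> + inverse b)"
  have Im_a: "Im a > 0" and Im_b: "Im b > 0"
    using \<tau> p(2) by (simp_all add: a_def b_def)
  have Im_\<sigma>: "Im \<sigma> > 0"
    unfolding \<sigma>_def by (rule Im_inverse_add_inverse_pos [OF Im_a]) simp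
  have Im_x: "Im x > 0"
    unfolding x_def by (rule Im_inverse_add_inverse_pos [OF Im_b]) simp
  have "u_fn \<sigma> = u_fn a"
    by (rule u_fn_invariant [of _ _ 1]) (use Im_a Im_\<sigma> in \<open>auto simp: \<sigma>_def divide_inverse\<close>)
  also have "\<dots> = u_fn (of_nat p * \<tau>)"
    unfolding a_def by (rule u_fn_add_of_int)
  finally have 1: "u_fn \<sigma> = u_fn (of_nat p * \<tau>)" .
  have "of_nat p * \<sigma> = x + of_int m / 3"
  proof -
    have nz: "a \<noteq> 0" "b \<noteq> 0" "18 * a + 1 \<noteq> 0" "18 * of_int \<epsilon> * b + 1 \<noteq> 0"
    proof -
      show "a \<noteq> 0" "b \<noteq> 0" using Im_a Im_b by auto
      have "Im (18 * a + 1) \<noteq> 0" "Im (18 * of_int \<epsilon> * b + 1) \<noteq> 0"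
        using Im_a Im_b \<epsilon> by auto
      then show "18 * a + 1 \<noteq> 0" "18 * of_int \<epsilon> * b + 1 \<noteq> 0"
        by (metis zero_complex.sel(2))+
    qed
    have sig: "\<sigma> = a / (18 * a + 1)" and x: "x = b / (18 * of_int \<epsilon> * b + 1)"
      unfolding \<sigma>_def x_def using nz by (simp_all add: divide_simps add_ac)
    have p': "complex_of_nat p = of_int \<epsilon> + 6 * of_int m"
      using arg_cong [OF p_eq, of of_int] by simp
    have "of_nat p * a * (18 * of_int \<epsilon> * b + 1) = (b + of_int m / 3 * (18 * of_int \<epsilon> * b + 1)) * (18 * a + 1)"
      unfolding a_def b_def p' using \<epsilon> by (auto simp: field_simps power2_eq_square)
    then have "of_nat p * a / (18 * a + 1) = (b + of_int m / 3 * (18 * of_int \<epsilon> * b + 1)) / (18 * of_int \<epsilon> * b + 1)"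
      using nz by (subst frac_eq_eq) auto
    also have "\<dots> = b / (18 * of_int \<epsilon> * b + 1) + of_int m / 3"
      using nz(4) by (simp only: add_divide_distrib nonzero_mult_div_cancel_right not_False_eq_True)
    finally show ?thesis
      by (simp add: sig x)
  qed
  then have "u_fn (of_nat p * \<sigma>) = e2pi (of_int m / 3) * u_fn x"
    by (simp only: u_fn_add_thirds)
  also have "u_fn x = u_fn b"
    by (rule u_fn_invariant [of _ _ \<epsilon>]) (use Im_b Im_x in \<open>auto simp: x_def divide_inverse\<close>)
  also have "\<dots> = e2pi (of_int (- m) / 3) * u_fn \<tau>"
    unfolding b_def by (rule u_fn_add_thirds)
  finally have "u_fn (of_nat p * \<sigma>) = u_fn \<tau>"
    by (simp add: e2pi_minus)
  with 1 Im_\<sigma> show ?thesis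
    using that by blast
qed

section \<open>The product over the conjugates of u\<close>

lemma prod_one_minus_roots_of_unity:
  fixes w x :: complex
  assumes w: "\<And>j. w ^ j = 1 \<longleftrightarrow> p dvd j" and p: "p > 0"
  shows "(\<Prod>k<p. 1 - w ^ k * x) = 1 - x ^ p"
proof -
  have "w \<noteq> 0"
    using w [of p] p by (auto simp: power_0_left)
  have inj: "inj_on (\<lambda>k. w ^ k) {..<p}"
  proof (rule linorder_inj_onI)
    fix j k assume jk: "j < k" "j \<in> {..<p}" "k \<in> {..<p}"
    show "w ^ j \<noteq> w ^ k"
    proof
      assume "w ^ j = w ^ k"
      then have "w ^ (k - j) = 1"
        using jk \<open>w \<noteq> 0\<close> by (simp add: power_diff)
      then have "p dvd k - j"
        by (simp add: w)
      with jk show False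
        by (auto dest: dvd_imp_le)
    qed
  qed auto
  let ?P = "\<Prod>k<p. [:1, - (w ^ k):]" and ?Q = "1 - monom 1 p :: complex poly"
  let ?A = "insert 0 ((\<lambda>k. inverse (w ^ k)) ` {..<p})"
  have "inj_on (\<lambda>k. inverse (w ^ k)) {..<p}"
    using inj by (auto simp: inj_on_def)
  then have card: "card ?A = Suc p"
    using \<open>w \<noteq> 0\<close> by (subst card_insert_disjoint) (auto simp: card_image)
  have "?P = ?Q"
  proof (rule poly_eqI_degree [where A = ?A])
    fix z assume "z \<in> ?A"
    then consider "z = 0" | k where "k < p" "z = inverse (w ^ k)"
      by auto
    then show "poly ?P z = poly ?Q z"
    proof cases
      case 1
      then show ?thesis
        using p by (simp add: poly_prod poly_monom power_0_left)
    next
      case 2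
      have "(w ^ k) ^ p = 1"
        by (simp add: power_mult [symmetric] w)
      then have "poly ?Q z = 0"
        using 2 by (simp add: poly_monom power_inverse)
      moreover have "poly ?P z = 0"
        using 2 \<open>w \<noteq> 0\<close> by (auto simp: poly_prod intro!: prod_zero bexI [of _ k])
      ultimately show ?thesis by simp
    qed
  next
    have "degree ?P \<le> (\<Sum>k<p. degree [:1, - (w ^ k):])"
      by (rule degree_prod_sum_le [OF finite_lessThan, unfolded o_def])
    also have "\<dots> \<le> (\<Sum>k<p. 1)"
      by (intro sum_mono) auto
    finally show "degree ?P < card ?A"
      by (simp add: card)
    have "degree ?Q \<le> p"
      by (intro degree_diff_le) (auto simp: degree_monom_le)
    then show "degree ?Q < card ?A"
      by (simp add: card)
  qed
  from arg_cong [OF this, of "\<lambda>P. poly P x"] show ?thesis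
    by (simp add: poly_prod poly_monom mult_ac)
qed

lemma prod_lessThan_add:
  fixes f :: "nat \<Rightarrow> 'a :: comm_monoid_mult"
  shows "prod f {..<a + b} = prod f {..<a} * (\<Prod>i<b. f (a + i))"
  by (induction b) (simp_all add: mult_ac)

text \<open>
  The factors of \<open>f\<close> and \<open>g\<close> differ only at the multiples of \<open>p\<close>. The partial products are cut
  off at a multiple of \<open>p\<close> in order that all four have the right limit for \<open>N \<longlonglongrightarrow> \<infinity>\<close>.
\<close>
lemma prod_exchange_multiples:
  fixes f g :: "nat \<Rightarrow> 'a :: comm_monoid_mult"
  assumes eq: "\<And>n. \<not> p dvd n \<Longrightarrow> f n = g n" and p: "p > 0"
  shows "(\<Prod>n<p * N. f (Suc n)) * (\<Prod>m<N. g (p * Suc m)) =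
    (\<Prod>n<p * N. g (Suc n)) * (\<Prod>m<N. f (p * Suc m))"
proof (induction N)
  case (Suc N)
  obtain q where q: "p = Suc q" using p by (cases p) auto
  have split: "(\<Prod>n<p * Suc N. h (Suc n)) =
      (\<Prod>n<p * N. h (Suc n)) * (\<Prod>i<q. h (Suc (p * N + i))) * h (p * Suc N)" for h :: "nat \<Rightarrow> 'a"
  proof -
    have "p * Suc N = p * N + Suc q" by (simp add: q)
    then have "(\<Prod>n<p * Suc N. h (Suc n)) = (\<Prod>n<p * N. h (Suc n)) * (\<Prod>i<Suc q. h (Suc (p * N + i)))"
      by (simp only: prod_lessThan_add)
    also have "\<dots> = (\<Prod>n<p * N. h (Suc n)) * (\<Prod>i<q. h (Suc (p * N + i))) * h (p * Suc N)"
      by (simp add: q mult_ac add_ac)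
    finally show ?thesis .
  qed
  have "(\<Prod>i<q. f (Suc (p * N + i))) = (\<Prod>i<q. g (Suc (p * N + i)))"
  proof (intro prod.cong refl eq)
    fix i assume "i \<in> {..<q}"
    then have "0 < Suc i" "Suc i < p" by (auto simp: q)
    then have "\<not> p dvd Suc i"
      by (auto dest: dvd_imp_le)
    then show "\<not> p dvd Suc (p * N + i)"
      by (metis add_Suc_right dvd_add_right_iff dvd_triv_left)
  qed
  then have "(\<Prod>n<p * Suc N. f (Suc n)) * (\<Prod>m<Suc N. g (p * Suc m)) =
      ((\<Prod>n<p * N. f (Suc n)) * (\<Prod>m<N. g (p * Suc m))) *
      ((\<Prod>i<q. g (Suc (p * N + i))) * f (p * Suc N) * g (p * Suc N))"
    unfolding split prod.lessThan_Suc by (simp only: mult_ac)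
  also have "\<dots> = (\<Prod>n<p * Suc N. g (Suc n)) * (\<Prod>m<Suc N. f (p * Suc m))"
    unfolding Suc.IH split prod.lessThan_Suc by (simp only: mult_ac)
  finally show ?case .
qed auto

lemma norm_power_less_1:
  fixes x :: "'a :: real_normed_div_algebra"
  shows "norm x < 1 \<Longrightarrow> n > 0 \<Longrightarrow> norm (x ^ n) < 1"
  by (simp add: norm_power power_less_one_iff)

text \<open>
  In the product over \<open>k\<close>, the \<open>n\<close>-th factors multiply to \<open>1 - y\<^bsup>pn\<^esup>\<close> if \<open>p\<close> does not divide \<open>n\<close>, since then
  \<open>w\<^sup>n\<close> is again a primitive \<open>p\<close>-th root of unity, and to \<open>(1 - y\<^sup>n)\<^sup>p\<close> otherwise. Hence the product is
  \<open>euler_prod (y\<^sup>p)\<close> with its factors at the multiples of \<open>p\<close> replaced. The removed factors form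
  \<open>euler_prod (y\<^bsup>pp\<^esup>)\<close>, the inserted ones \<open>euler_prod (y\<^sup>p)\<^sup>p\<close>.
\<close>
lemma prod_euler_prod_roots_of_unity:
  assumes p: "prime p" and w: "\<And>j. w ^ j = 1 \<longleftrightarrow> p dvd j" and y: "norm y < 1"
  shows "(\<Prod>k<p. euler_prod (w ^ k * y)) * euler_prod (y ^ (p * p)) = euler_prod (y ^ p) ^ Suc p"
proof (rule LIMSEQ_unique)
  have p0: "p > 0" using p prime_gt_0_nat by blast
  have "w ^ p = 1" by (simp add: w)
  then have nw: "norm w = 1"
    using p0 by (metis norm_ge_zero norm_one norm_power power_eq_1_iff neq0_conv)
  have lim: "(\<lambda>N. \<Prod>n<N. 1 - x ^ Suc n) \<longlonglongrightarrow> euler_prod x" if "norm x < 1" for x :: complex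
    using qpoch_LIMSEQ [OF that, of x] by simp
  have lim': "(\<lambda>N. \<Prod>n<p * N. 1 - x ^ Suc n) \<longlonglongrightarrow> euler_prod x" if "norm x < 1" for x :: complex
    using LIMSEQ_subseq_LIMSEQ [OF lim [OF that], of "\<lambda>N. p * N"] p0
    by (simp add: strict_mono_def o_def)
  define f where "f = (\<lambda>n. \<Prod>k<p. 1 - (w ^ k * y) ^ n)"
  define g where "g = (\<lambda>n. 1 - (y ^ p) ^ n)"
  have f_eq: "f n = g n" if "\<not> p dvd n" for n
  proof -
    have "(w ^ n) ^ j = 1 \<longleftrightarrow> p dvd j" for j
      using that p by (simp add: power_mult [symmetric] w prime_dvd_mult_iff)
    from prod_one_minus_roots_of_unity [OF this p0, of "y ^ n"] show ?thesis
      by (simp add: f_def g_def power_mult_distrib power_mult [symmetric] mult.commute)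
  qed
  have f_mult: "f (p * m) = (1 - (y ^ p) ^ m) ^ p" for m
  proof -
    have "(w ^ k) ^ (p * m) = 1" for k
      by (simp add: power_mult [symmetric] w)
    then show ?thesis
      by (simp add: f_def power_mult_distrib power_mult)
  qed
  have "(\<lambda>N. (\<Prod>k<p. \<Prod>n<p * N. 1 - (w ^ k * y) ^ Suc n) * (\<Prod>m<N. 1 - (y ^ (p * p)) ^ Suc m))
      \<longlonglongrightarrow> (\<Prod>k<p. euler_prod (w ^ k * y)) * euler_prod (y ^ (p * p))"
    by (intro tendsto_intros lim lim' norm_power_less_1) (use y nw p0 in \<open>auto simp: norm_mult norm_power\<close>)
  also have "(\<lambda>N. (\<Prod>k<p. \<Prod>n<p * N. 1 - (w ^ k * y) ^ Suc n) * (\<Prod>m<N. 1 - (y ^ (p * p)) ^ Suc m)) =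
      (\<lambda>N. (\<Prod>n<p * N. f (Suc n)) * (\<Prod>m<N. g (p * Suc m)))"
    unfolding f_def g_def by (subst prod.swap) (simp only: power_mult)
  finally show "(\<lambda>N. (\<Prod>n<p * N. f (Suc n)) * (\<Prod>m<N. g (p * Suc m)))
      \<longlonglongrightarrow> (\<Prod>k<p. euler_prod (w ^ k * y)) * euler_prod (y ^ (p * p))" .
  have exchange: "(\<Prod>n<p * N. f (Suc n)) * (\<Prod>m<N. g (p * Suc m)) =
      (\<Prod>n<p * N. g (Suc n)) * (\<Prod>m<N. 1 - (y ^ p) ^ Suc m) ^ p" for N
  proof -
    have "(\<Prod>n<p * N. f (Suc n)) * (\<Prod>m<N. g (p * Suc m)) =
        (\<Prod>n<p * N. g (Suc n)) * (\<Prod>m<N. f (p * Suc m))"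
      by (rule prod_exchange_multiples) (use f_eq p0 in auto)
    then show ?thesis
      by (simp only: f_mult prod_power_distrib)
  qed
  have "(\<lambda>N. (\<Prod>n<p * N. g (Suc n)) * (\<Prod>m<N. 1 - (y ^ p) ^ Suc m) ^ p)
      \<longlonglongrightarrow> euler_prod (y ^ p) * euler_prod (y ^ p) ^ p"
    unfolding g_def by (intro tendsto_intros lim lim' norm_power_less_1 y p0)
  then show "(\<lambda>N. (\<Prod>n<p * N. f (Suc n)) * (\<Prod>m<N. g (p * Suc m))) \<longlonglongrightarrow> euler_prod (y ^ p) ^ Suc p"
    by (simp only: exchange power_Suc)
qed

lemma e2pi_root_power_eq_1_iff:
  assumes "p > 0"
  shows "e2pi (1 / of_nat p) ^ j = 1 \<longleftrightarrow> p dvd j"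
proof -
  have "e2pi (1 / of_nat p) ^ j = 1 \<longleftrightarrow> (of_nat j / of_nat p :: complex) \<in> \<int>"
    by (simp add: e2pi_power e2pi_eq_1_iff)
  also have "\<dots> \<longleftrightarrow> p dvd j"
  proof
    assume "(of_nat j / of_nat p :: complex) \<in> \<int>"
    then obtain k :: int where "of_nat j / of_nat p = (of_int k :: complex)"
      by (auto elim: Ints_cases)
    then have "of_int (int j) = (of_int (k * int p) :: complex)"
      using assms by (simp add: field_simps)
    then have "int j = k * int p"
      by (simp only: of_int_eq_iff)
    then show "p dvd j"
      by (metis dvd_triv_right int_dvd_int_iff)
  qed (use assms in \<open>auto elim!: dvdE\<close>)
  finally show ?thesis .
qed

text \<open>
  In terms of \<open>\<tau>\<close>, with \<open>x = exp (2\<pi>i\<tau> / p)\<close>: the product of \<open>u((\<tau> + k) / p)\<close> over all \<open>k\<close> modulo \<open>p\<close>,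
  times \<open>u(p\<tau>)\<close>, is \<open>u(\<tau>)\<^bsup>p + 1\<^esup>\<close>. The eta factors are of the form treated above because \<open>p\<close> is prime to
  their levels, which makes powers of \<open>\<zeta>\<close> to those levels primitive again.
\<close>
lemma prod_u_of_q_conjugates:
  assumes p: "prime p" "coprime p 6" and x: "norm x < 1"
  defines "\<zeta> \<equiv> e2pi (1 / of_nat p)"
  shows "(\<Prod>k<p. u_of_q (\<zeta> ^ k * x)) * u_of_q (x ^ (p * p)) = u_of_q (x ^ p) ^ Suc p"
proof -
  have p0: "p > 0" using p prime_gt_0_nat by blast
  have \<zeta>: "\<zeta> ^ j = 1 \<longleftrightarrow> p dvd j" for j
    unfolding \<zeta>_def by (rule e2pi_root_power_eq_1_iff [OF p0])
  have E: "(\<Prod>k<p. euler_prod ((\<zeta> ^ k * x) ^ m)) * euler_prod ((x ^ (p * p)) ^ m) = euler_prod ((x ^ p) ^ m) ^ Suc p"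
    if m: "m \<in> {3, 18, 6, 9}" for m
  proof -
    have "coprime p (6 ^ 2)"
      using p(2) by (simp only: coprime_power_right_iff simp_thms)
    moreover have "m dvd 6 ^ 2"
      using m by auto
    ultimately have "coprime p m"
      using coprime_divisors dvd_refl by blast
    then have "(\<zeta> ^ m) ^ j = 1 \<longleftrightarrow> p dvd j" for j
      by (simp add: power_mult [symmetric] \<zeta> coprime_dvd_mult_right_iff)
    moreover have "norm (x ^ m) < 1"
      using x m by (intro norm_power_less_1) auto
    ultimately have "(\<Prod>k<p. euler_prod ((\<zeta> ^ m) ^ k * x ^ m)) * euler_prod ((x ^ m) ^ (p * p)) =
        euler_prod ((x ^ m) ^ p) ^ Suc p"
      by (intro prod_euler_prod_roots_of_unity p)
    moreover have "(\<zeta> ^ k * x) ^ m = (\<zeta> ^ m) ^ k * x ^ m" for k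
      by (simp add: power_mult_distrib power_mult [symmetric] mult.commute)
    moreover have "(x ^ n) ^ m = (x ^ m) ^ n" for n
      by (simp add: power_mult [symmetric] mult.commute)
    ultimately show ?thesis
      by (simp only:)
  qed
  have lead: "(\<Prod>k<p. \<zeta> ^ k * x) * x ^ (p * p) = (x ^ p) ^ Suc p"
  proof -
    have "odd p"
      using p(2) coprime_common_divisor [of p 6 2] by auto
    then have "(\<Sum>k<p. k) = p * ((p - 1) div 2)"
      by (auto simp: Sum_Ico_nat lessThan_atLeast0 elim!: oddE)
    then have "(\<Prod>k<p. \<zeta> ^ k) = 1"
      by (simp add: power_sum [symmetric] \<zeta>)
    then show ?thesis
      by (simp add: prod.distrib power_mult)
  qed
  have collect: "(\<Prod>k<p. a k * b k * c k ^ 3 / (d k * e k ^ 3)) * (a' * b' * c' ^ 3 / (d' * e' ^ 3)) =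
      (prod a {..<p} * a') * (prod b {..<p} * b') * (prod c {..<p} * c') ^ 3 /
      ((prod d {..<p} * d') * (prod e {..<p} * e') ^ 3)"
    for a b c d e :: "nat \<Rightarrow> complex" and a' b' c' d' e'
    by (simp add: prod_dividef prod.distrib prod_power_distrib power_mult_distrib mult_ac)
  have pow: "(a * b * c ^ 3 / (d * e ^ 3)) ^ n = a ^ n * b ^ n * (c ^ n) ^ 3 / (d ^ n * (e ^ n) ^ 3)"
    for a b c d e :: complex and n
    by (simp add: power_divide power_mult_distrib power_mult [symmetric] mult.commute)
  have "3 \<in> {3, 18, 6, 9 :: nat}" "18 \<in> {3, 18, 6, 9 :: nat}" "6 \<in> {3, 18, 6, 9 :: nat}" "9 \<in> {3, 18, 6, 9 :: nat}"
    by simp_all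
  note Es = this [THEN E]
  show ?thesis
    unfolding u_of_q_def collect pow lead Es ..
qed

text \<open>
  \<open>u = q + \<dots>\<close> has derivative \<open>1\<close> at \<open>q = 0\<close>.
\<close>
lemma u_of_q_locally_injective:
  obtains r where "r > 0" "r \<le> 1" "inj_on u_of_q (ball 0 r)"
proof -
  define V where "V = (\<lambda>x. euler_prod (x ^ 3) * euler_prod (x ^ 18) ^ 3 / (euler_prod (x ^ 6) * euler_prod (x ^ 9) ^ 3))"
  have u_of_q_eq: "u_of_q = (\<lambda>x. x * V x)"
    by (simp add: u_of_q_def V_def fun_eq_iff)
  have holV: "V holomorphic_on ball 0 1"
    unfolding V_def by (intro holomorphic_intros) (auto simp: norm_power_less_1 euler_prod_nonzero)
  then have holU: "u_of_q holomorphic_on ball 0 1"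
    unfolding u_of_q_eq by (intro holomorphic_intros)
  have "(V has_field_derivative deriv V 0) (at 0)"
    by (rule holomorphic_derivI [OF holV]) auto
  then have "(u_of_q has_field_derivative V 0) (at 0)"
    unfolding u_of_q_eq by (auto intro!: derivative_eq_intros)
  moreover have "V 0 = 1"
    by (simp add: V_def)
  ultimately have "deriv u_of_q 0 \<noteq> 0"
    by (simp add: DERIV_imp_deriv)
  then obtain r where "r > 0" "ball 0 r \<subseteq> ball (0::complex) 1" "inj_on u_of_q (ball 0 r)"
    using has_complex_derivative_locally_injective [OF holU, of 0] by auto
  moreover from this have "r \<le> 1"
    by (simp add: ball_subset_ball_iff)
  ultimately show ?thesis
    using that by blast
qed

section \<open>Coefficients of the modular equation\<close>

lemma poly_eq_smult_prod_roots:
  fixes P :: "'a :: field poly"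
  assumes deg: "degree P \<le> n" and inj: "inj_on r {..<n}"
    and root: "\<And>k. k < n \<Longrightarrow> poly P (r k) = 0"
  shows "P = smult (coeff P n) (\<Prod>k<n. [:- r k, 1:])"
proof (cases "n = 0")
  case True
  then show ?thesis
    using deg by (simp add: degree_eq_zeroE) (metis coeff_pCons_0 degree_eq_zeroE)
next
  case False
  let ?M = "\<Prod>k<n. [:- r k, 1:]"
  let ?D = "P - smult (coeff P n) ?M"
  have degM: "degree ?M = n"
    by (subst degree_prod_eq_sum_degree) auto
  have "lead_coeff ?M = 1"
    by (simp add: lead_coeff_prod)
  then have "coeff ?D n = 0"
    by (simp add: degM)
  moreover have "degree ?D \<le> n"
    by (intro degree_diff_le deg order_trans [OF degree_smult_le]) (simp add: degM)
  ultimately have degD: "degree ?D < n"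
    using False by (metis coeff_0 degree_0 leading_coeff_0_iff le_neq_implies_less neq0_conv)
  have "?D = 0"
  proof (rule poly_eqI_degree [where A = "r ` {..<n}"])
    fix z assume "z \<in> r ` {..<n}"
    then obtain k where k: "k < n" "z = r k" by auto
    have "poly ?M z = 0"
      using k by (auto simp: poly_prod intro!: prod_zero bexI [of _ k])
    then show "poly ?D z = poly 0 z"
      using root k by simp
  qed (use degD False in \<open>simp_all add: card_image [OF inj]\<close>)
  then show ?thesis by simp
qed

text \<open>
  Let \<open>a\<^sub>j(X)\<close> be the coefficient of \<open>Y\<^sup>j\<close>. For \<open>X = u(\<tau>)\<close>, the two relations provide the roots
  \<open>Y = u(p\<tau>)\<close> and \<open>Y = u((\<tau> + k) / p)\<close>. If \<open>\<tau>\<close> is high up in the half-plane, then local injectivity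
  makes them \<open>p + 1\<close> distinct numbers, as many as the degree in \<open>Y\<close> admits. Their product is
  \<open>X\<^bsup>p + 1\<^esup>\<close>, so \<open>a\<^sub>0(X) = a\<^bsub>p + 1\<^esub>(X) X\<^bsup>p + 1\<^esup>\<close> at infinitely many \<open>X\<close>, hence identically. The bound
  \<open>p + 1\<close> for the degree in \<open>X\<close> then leaves only a constant for \<open>a\<^bsub>p + 1\<^esub>\<close>, and that constant is not zero,
  because otherwise the polynomial in \<open>Y\<close> would have more roots than its degree for infinitely many \<open>X\<close>
  and thus vanish identically.
\<close>
lemma coefficients_of_relation:
  fixes c :: "nat \<Rightarrow> nat \<Rightarrow> complex"
  assumes p: "prime p" "coprime p 6"
    and rel: "\<And>x. 0 < norm x \<Longrightarrow> norm x < 1 \<Longrightarrow>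
      (\<Sum>i\<le>p + 1. \<Sum>j\<le>p + 1. c i j * u_of_q x ^ i * u_of_q (x ^ p) ^ j) = 0"
    and rel': "\<And>x. 0 < norm x \<Longrightarrow> norm x < 1 \<Longrightarrow>
      (\<Sum>i\<le>p + 1. \<Sum>j\<le>p + 1. c i j * u_of_q (x ^ p) ^ i * u_of_q x ^ j) = 0"
    and nz: "\<exists>i\<le>p + 1. \<exists>j\<le>p + 1. c i j \<noteq> 0"
  shows "c 0 (p + 1) \<noteq> 0" and "c (p + 1) 0 \<noteq> 0"
    and "\<forall>i\<in>{1..p + 1}. c i (p + 1) = 0" and "\<forall>i\<in>{0..p}. c i 0 = 0"
proof -
  have p1: "p > 1" using p prime_gt_1_nat by blast
  have "odd p"
    using p(2) coprime_common_divisor [of p 6 2] by auto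
  define a where "a = (\<lambda>j. \<Sum>i\<le>p + 1. monom (c i j) i)"
  have coeff_a: "coeff (a j) i = (if i \<le> p + 1 then c i j else 0)" for i j
    by (simp add: a_def coeff_sum)
  have poly_a: "poly (a j) X = (\<Sum>i\<le>p + 1. c i j * X ^ i)" for j X
    by (simp add: a_def poly_sum poly_monom)
  have rel_a: "(\<Sum>j\<le>p + 1. poly (a j) X * Y ^ j) = (\<Sum>i\<le>p + 1. \<Sum>j\<le>p + 1. c i j * X ^ i * Y ^ j)" for X Y
    unfolding poly_a sum_distrib_right by (rule sum.swap)
  obtain r where r: "r > 0" "r \<le> 1" and inj: "inj_on u_of_q (ball 0 r)"
    using u_of_q_locally_injective .
  define X where "X = (\<lambda>t. u_of_q (of_real t ^ p))"
  have inf: "infinite (X ` {0<..<r})"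
  proof -
    have "inj_on X {0<..<r}"
    proof (rule inj_onI)
      fix s t assume st: "s \<in> {0<..<r}" "t \<in> {0<..<r}" and eq: "X s = X t"
      have "of_real u ^ p \<in> ball (0 :: complex) r" if "u \<in> {0<..<r}" for u :: real
      proof -
        have "u ^ p \<le> u ^ 1"
          using that r p1 by (intro power_decreasing) auto
        then show ?thesis
          using that by (simp add: norm_power)
      qed
      with inj eq st have "of_real s ^ p = (of_real t ^ p :: complex)"
        unfolding X_def by (auto dest: inj_onD)
      then have "s ^ p = t ^ p"
        by (metis of_real_eq_iff of_real_power)
      then show "s = t"
        using st p1 by (auto simp: power_eq_iff_eq_base)
    qed
    then show ?thesis
      using r by (simp add: finite_image_iff)
  qed
  \<comment> \<open>Here \<open>X t = u(\<tau>)\<close> with \<open>exp (2\<pi>i\<tau> / p) = t\<close>; the index \<open>k = p\<close> stands for the root \<open>u(p\<tau>)\<close>.\<close>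
  have fibre: "(\<Sum>j\<le>p + 1. monom (poly (a j) (X t)) j) =
      smult (poly (a (p + 1)) (X t)) (\<Prod>k<p + 1. [:- \<rho> k, 1:]) \<and>
      (\<Prod>k<p + 1. \<rho> k) = X t ^ (p + 1)"
    if t: "t \<in> {0<..<r}" and \<rho>: "\<rho> = (\<lambda>k. u_of_q (if k < p then e2pi (1 / of_nat p) ^ k * of_real t else of_real t ^ (p * p)))"
    for t \<rho>
  proof
    define \<zeta> where "\<zeta> = e2pi (1 / of_nat p)"
    define y where "y = (\<lambda>k. if k < p then \<zeta> ^ k * of_real t else of_real t ^ (p * p))"
    have \<rho>': "\<rho> = (\<lambda>k. u_of_q (y k))"
      unfolding \<rho> y_def \<zeta>_def ..
    have \<zeta>_p: "\<zeta> ^ j = 1 \<longleftrightarrow> p dvd j" for j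
      unfolding \<zeta>_def by (rule e2pi_root_power_eq_1_iff) (use p1 in simp)
    have norm_\<zeta>: "norm \<zeta> = 1"
      by (simp add: \<zeta>_def norm_e2pi)
    have small: "t ^ (p * p) < t"
    proof -
      have "1 < p * p" using p1 by (simp add: one_less_mult)
      then show ?thesis
        using power_strict_decreasing [of 1 "p * p" t] t r by simp
    qed
    have norm_y: "norm (y k) = (if k < p then t else t ^ (p * p))" for k
      using t by (simp add: y_def norm_mult norm_power norm_\<zeta>)
    have y_ball: "y k \<in> ball 0 r" for k
      using t small by (simp add: norm_y)
    have inj_y: "inj_on y {..<p + 1}"
    proof (rule linorder_inj_onI)
      fix j k assume jk: "j < k" "j \<in> {..<p + 1}" "k \<in> {..<p + 1}"
      show "y j \<noteq> y k"
      proof (cases "k < p")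
        case True
        show ?thesis
        proof
          assume "y j = y k"
          then have "\<zeta> ^ j = \<zeta> ^ k"
            using True jk t by (simp add: y_def)
          then have "\<zeta> ^ (k - j) = 1"
            using jk by (simp add: power_diff \<zeta>_def)
          then have "p dvd k - j"
            by (simp add: \<zeta>_p)
          with jk True show False
            by (auto dest: dvd_imp_le)
        qed
      next
        case False
        then have "norm (y j) \<noteq> norm (y k)"
          using jk small by (simp add: norm_y)
        then show ?thesis by auto
      qed
    qed auto
    have inj_\<rho>: "inj_on \<rho> {..<p + 1}"
      unfolding \<rho>' using inj_y inj y_ball by (auto simp: inj_on_def)
    let ?P = "\<Sum>j\<le>p + 1. monom (poly (a j) (X t)) j"
    have "poly ?P Y = (\<Sum>i\<le>p + 1. \<Sum>j\<le>p + 1. c i j * X t ^ i * Y ^ j)" for Y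
      by (simp only: poly_sum poly_monom rel_a)
    then have eval: "poly ?P (\<rho> k) = (\<Sum>i\<le>p + 1. \<Sum>j\<le>p + 1. c i j * u_of_q (of_real t ^ p) ^ i * u_of_q (y k) ^ j)" for k
      unfolding \<rho>' X_def .
    have "?P = smult (coeff ?P (p + 1)) (\<Prod>k<p + 1. [:- \<rho> k, 1:])"
    proof (rule poly_eq_smult_prod_roots [OF _ inj_\<rho>])
      show "degree ?P \<le> p + 1"
        by (intro degree_sum_le) (auto intro: order_trans [OF degree_monom_le])
      fix k assume k: "k < p + 1"
      show "poly ?P (\<rho> k) = 0"
      proof (cases "k < p")
        case True
        have "y k ^ p = of_real t ^ p"
          using True by (simp add: y_def power_mult_distrib power_mult [symmetric] \<zeta>_p)
        moreover have "0 < norm (y k)" "norm (y k) < 1"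
          using t r norm_y [of k] True by auto
        ultimately show ?thesis
          using rel' [of "y k"] by (simp only: eval)
      next
        case False
        \<comment> \<open>The root \<open>u(p\<tau>)\<close> comes from the relation at \<open>\<tau>\<close> itself, that is, at \<open>t\<^sup>p\<close>.\<close>
        have "0 < t ^ p" "t ^ p < 1"
          using t r p1 by (auto simp: power_less_one_iff)
        then have "0 < norm (of_real t ^ p :: complex)" "norm (of_real t ^ p :: complex) < 1"
          using t by (simp_all add: norm_power)
        moreover have "y k = (of_real t ^ p) ^ p"
          using False by (simp add: y_def power_mult)
        ultimately show ?thesis
          using rel [of "of_real t ^ p"] by (simp only: eval)
      qed
    qed
    then show "?P = smult (poly (a (p + 1)) (X t)) (\<Prod>k<p + 1. [:- \<rho> k, 1:])"
      by (simp add: coeff_sum)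
    have "(\<Prod>k<p + 1. \<rho> k) = (\<Prod>k<p. u_of_q (\<zeta> ^ k * of_real t)) * u_of_q (of_real t ^ (p * p))"
      by (simp add: \<rho>' y_def)
    also have "\<dots> = X t ^ (p + 1)"
      unfolding \<zeta>_def X_def using t r prod_u_of_q_conjugates [OF p, of "of_real t"] by simp
    finally show "(\<Prod>k<p + 1. \<rho> k) = X t ^ (p + 1)" .
  qed
  have poly_eqI_inf: "P = Q" if "\<And>t. t \<in> {0<..<r} \<Longrightarrow> poly P (X t) = poly Q (X t)" for P Q :: "complex poly"
  proof -
    have "X ` {0<..<r} \<subseteq> {z. poly (P - Q) z = 0}"
      using that by auto
    then have "infinite {z. poly (P - Q) z = 0}"
      using inf finite_subset by blast
    then show ?thesis
      using poly_roots_finite [of "P - Q"] by auto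
  qed
  have a0: "a 0 = a (p + 1) * monom 1 (p + 1)"
  proof (rule poly_eqI_inf)
    fix t assume t: "t \<in> {0<..<r}"
    note F = fibre [OF t refl]
    have "poly (a 0) (X t) = poly (\<Sum>j\<le>p + 1. monom (poly (a j) (X t)) j) 0"
      by (simp add: poly_0_coeff_0 coeff_sum)
    also have "\<dots> = poly (a (p + 1)) (X t) * X t ^ (p + 1)"
      unfolding F [THEN conjunct1] F [THEN conjunct2, symmetric] using \<open>odd p\<close>
      by (simp add: poly_prod prod_uminus)
    finally show "poly (a 0) (X t) = poly (a (p + 1) * monom 1 (p + 1)) (X t)"
      by (simp add: poly_monom)
  qed
  have top: "a (p + 1) \<noteq> 0"
  proof
    assume "a (p + 1) = 0"
    have "a j = 0" if "j \<le> p + 1" for j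
    proof (rule poly_eqI_inf)
      fix t assume t: "t \<in> {0<..<r}"
      have "(\<Sum>j\<le>p + 1. monom (poly (a j) (X t)) j) = 0"
        using fibre [OF t refl] \<open>a (p + 1) = 0\<close> by simp
      from arg_cong [OF this, of "\<lambda>P. coeff P j"] that
      show "poly (a j) (X t) = poly 0 (X t)"
        by (simp add: coeff_sum split: if_splits)
    qed
    with nz coeff_a show False
      by (metis coeff_0)
  qed
  have "degree (a 0) \<le> p + 1"
    unfolding a_def by (intro degree_sum_le) (auto intro: order_trans [OF degree_monom_le])
  moreover have "degree (a 0) = degree (a (p + 1)) + (p + 1)"
    unfolding a0 using top by (subst degree_mult_eq) (auto simp: degree_monom_eq monom_eq_0_iff)
  ultimately have "degree (a (p + 1)) = 0"
    by simp
  then obtain e where e: "a (p + 1) = [:e:]"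
    by (rule degree_eq_zeroE)
  with top have "e \<noteq> 0" by auto
  have c_top: "c i (p + 1) = (if i = 0 then e else 0)" if "i \<le> p + 1" for i
    using coeff_a [of "p + 1" i, unfolded e] that by (cases i) simp_all
  have c_0: "c i 0 = (if i = p + 1 then e else 0)" if "i \<le> p + 1" for i
    using coeff_a [of 0 i, unfolded a0 e] that by (simp split: if_splits)
  show "c 0 (p + 1) \<noteq> 0" "c (p + 1) 0 \<noteq> 0"
    "\<forall>i\<in>{1..p + 1}. c i (p + 1) = 0" "\<forall>i\<in>{0..p}. c i 0 = 0"
    using \<open>e \<noteq> 0\<close> by (auto simp: c_top [simplified] c_0 [simplified])
qed

theorem theorem4p6:
  fixes p :: nat and C :: "nat \<Rightarrow> nat \<Rightarrow> rat"
  assumes "prime p" and "p \<ge> 5"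
    and "is_modular_equation p (poly_of_coeffs (p + 1) C)"
  shows "(C (p + 1) 0 \<noteq> 0 \<and> C 0 (p + 1) \<noteq> 0) \<and>
         (\<forall>j\<in>{1..p + 1}. C (p + 1) j = 0 \<and> C j (p + 1) = 0) \<and>
         (\<forall>j\<in>{0..p}. C 0 j = 0 \<and> C j 0 = 0)"
proof -
  have p: "coprime p 6"
  proof -
    have "\<not> p dvd 2" "\<not> p dvd 3"
      using assms(2) by (auto dest!: dvd_imp_le)
    then have "\<not> p dvd 2 * 3"
      by (simp only: prime_dvd_mult_iff [OF assms(1)] simp_thms)
    then show ?thesis
      using prime_imp_coprime [OF assms(1), of "2 * 3"] by simp
  qed
  let ?c = "\<lambda>i j. of_rat (C i j) :: complex"
  have zero: "(\<Sum>i\<le>p + 1. \<Sum>j\<le>p + 1. ?c i j * u_fn \<tau> ^ i * u_fn (of_nat p * \<tau>) ^ j) = 0"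
    if "Im \<tau> > 0" for \<tau>
    using assms(3) that unfolding is_modular_equation_def eval2_poly_of_coeffs by blast
  have rel: "(\<Sum>i\<le>p + 1. \<Sum>j\<le>p + 1. ?c i j * u_of_q x ^ i * u_of_q (x ^ p) ^ j) = 0"
    and rel': "(\<Sum>i\<le>p + 1. \<Sum>j\<le>p + 1. ?c i j * u_of_q (x ^ p) ^ i * u_of_q x ^ j) = 0"
    if x: "0 < norm x" "norm x < 1" for x
  proof -
    define \<tau> where "\<tau> = Ln x / (2 * of_real pi * \<i>)"
    have x_eq: "x = e2pi \<tau>"
      using x(1) by (simp add: \<tau>_def e2pi_surj)
    have \<tau>: "Im \<tau> > 0"
      using x(2) by (simp add: x_eq norm_e2pi zero_less_mult_iff)
    have u: "u_fn \<tau> = u_of_q x" "u_fn (of_nat p * \<tau>) = u_of_q (x ^ p)"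
      by (simp_all add: u_fn_conv_u_of_q x_eq e2pi_power)
    show "(\<Sum>i\<le>p + 1. \<Sum>j\<le>p + 1. ?c i j * u_of_q x ^ i * u_of_q (x ^ p) ^ j) = 0"
      using zero [OF \<tau>] by (simp only: u)
    obtain \<sigma> where "Im \<sigma> > 0" "u_fn \<sigma> = u_of_q (x ^ p)" "u_fn (of_nat p * \<sigma>) = u_of_q x"
      using u_fn_swap [OF \<tau> p] assms(2) u by (metis less_le_trans zero_less_numeral)
    then show "(\<Sum>i\<le>p + 1. \<Sum>j\<le>p + 1. ?c i j * u_of_q (x ^ p) ^ i * u_of_q x ^ j) = 0"
      using zero [of \<sigma>] by simp
  qed
  have nz: "\<exists>i\<le>p + 1. \<exists>j\<le>p + 1. ?c i j \<noteq> 0"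
  proof (rule ccontr)
    assume "\<not> ?thesis"
    then have "poly_of_coeffs (p + 1) C = 0"
      by (simp add: poly_of_coeffs_def)
    then show False
      using assms(3) by (simp add: is_modular_equation_def)
  qed
  note 1 = coefficients_of_relation [of p ?c, OF assms(1) p rel rel' nz]
  \<comment> \<open>The two relations change places under transposition, so the lemma also applies to the transpose.\<close>
  have swap: "(\<Sum>i\<le>p + 1. \<Sum>j\<le>p + 1. ?c j i * X ^ i * Y ^ j) = (\<Sum>i\<le>p + 1. \<Sum>j\<le>p + 1. ?c i j * Y ^ i * X ^ j)" for X Y
    by (subst sum.swap) (simp add: mult_ac)
  have nz': "\<exists>i\<le>p + 1. \<exists>j\<le>p + 1. ?c j i \<noteq> 0"
    using nz by blast
  note 2 = coefficients_of_relation [of p "\<lambda>i j. ?c j i", OF assms(1) p _ _ nz', unfolded swap, OF rel' rel]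
  show ?thesis
    using 1 2 by simp
qed

end
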